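(* Let $f\ge1$, $\hbar>0$, let $H_{\mathrm{QNF}}$ be a real polynomial in $f$ variables, let $n=(n_2,\dots,n_f)$ be a vector of nonnegative integers, let $E\in\mathbb{R}$, and let $I\in\mathbb{R}$ satisfy $$H_{\mathrm{QNF}}\big(I,\hbar(n_2+\tfrac12),\dots,\hbar(n_f+\tfrac12)\big)=E .$$ Define, for $x_1\in\mathbb{R}\setminus\{0\}$, $$\psi_{\mathrm{out}\,\pm}(x_1)=\Theta(\pm x_1)\,|x_1|^{-1/2+iI/\hbar},\qquad \psi_{\mathrm{in}\,\pm}(x_1)=\frac{1}{\sqrt{2\pi\hbar}}\int_{\mathbb{R}}\overline{\psi_{\mathrm{out}\,\mp}(y_1)}\,e^{\frac{i}{\hbar}x_1y_1}\,dy_1 .$$ Then $$\psi_{\mathrm{in}\,+}=S_{n\,11}\,\psi_{\mathrm{out}\,+}+S_{n\,12}\,\psi_{\mathrm{out}\,-},\qquad \psi_{\mathrm{in}\,-}=S_{n\,21}\,\psi_{\mathrm{out}\,+}+S_{n\,22}\,\psi_{\mathrm{out}\,-},$$ where $$S_n(E)=\frac{e^{i\left(\frac{\pi}{4}-\frac{I}{\hbar}\ln\hbar\right)}}{\sqrt{2\pi}}\,\Gamma\Big(\frac12-i\frac{I}{\hbar}\Big)\begin{pmatrix}-i\,e^{-\frac{\pi}{2}\frac{I}{\hbar}} & e^{\frac{\pi}{2}\frac{I}{\hbar}}\\ e^{\frac{\pi}{2}\frac{I}{\hbar}} & -i\,e^{-\frac{\pi}{2}\frac{I}{\hbar}}\end{pmatrix}.$$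 Consequently the transmission probability of mode $n$ is $$T_n(E):=|S_{n\,12}(E)|^2=\big(1+e^{-2\pi I/\hbar}\big)^{-1},$$ and the matrix $S_n$, regarded as a meromorphic function of the complex variable $I$, has poles at $I=-i\hbar(n_1+\tfrac12)$, $n_1=0,1,2,\dots$.
   Context: $\Theta$ is the Heaviside step function, $\Gamma$ the Gamma function, and the overline denotes complex conjugation. The integral defining $\psi_{\mathrm{in}\,\pm}$ is an improper (conditionally convergent) integral, and the identities for $\psi_{\mathrm{in}\,\pm}$ are identities of functions on $\mathbb{R}\setminus\{0\}$. The functions $\psi_{\mathrm{out}\,\pm}$ satisfy $\widehat{I}\psi=I\psi$ on $\mathbb{R}\setminus\{0\}$ for $\widehat{I}=\frac{\hbar}{i}\big(x_1\partial_{x_1}+\tfrac12\big)$. The matrix $S_n(E)$ is the local scattering matrix, at energy $E$ and in the mode with bath quantum numbers $n$, of the operator $H_{\mathrm{QNF}}(\widehat{I},\widehat{J}_2,\dots,\widehat{J}_f)$ with $\widehat{J}_k=\frac12(-\hbar^2\partial_{x_k}^2+x_k^2)$, whose eigenvalues are $\hbar(n_k+\tfrac12)$; its dependence on $E$ is through $I$. *)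

theory Defs
  imports "HOL-Complex_Analysis.Complex_Analysis" "HOL-Library.Poly_Mapping"
begin

text \<open>A real multivariate polynomial is a finitely supported map from monomials (finitely
  supported exponent vectors) to coefficients. The variables are numbered from 1.\<close>

definition polynomial_in :: "nat \<Rightarrow> ((nat \<Rightarrow>\<^sub>0 nat) \<Rightarrow>\<^sub>0 real) \<Rightarrow> bool" where
  "polynomial_in f H \<longleftrightarrow> (\<forall>m \<in> Poly_Mapping.keys H. Poly_Mapping.keys m \<subseteq> {1..f})"

definition poly_eval :: "((nat \<Rightarrow>\<^sub>0 nat) \<Rightarrow>\<^sub>0 real) \<Rightarrow> (nat \<Rightarrow> real) \<Rightarrow> real" where
  "poly_eval H v = (\<Sum>m \<in> Poly_Mapping.keys H.
     Poly_Mapping.lookup H m * (\<Prod>k \<in> Poly_Mapping.keys m. v k ^ Poly_Mapping.lookup m k))"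

text \<open>The point \<open>(I, \<hbar>(n\<^sub>2 + 1/2), \<dots>, \<hbar>(n\<^sub>f + 1/2))\<close>; only the entries \<open>n 2, \<dots>, n f\<close> of the
  bath quantum numbers matter for a polynomial in \<open>f\<close> variables.\<close>

definition action_point :: "real \<Rightarrow> real \<Rightarrow> (nat \<Rightarrow> nat) \<Rightarrow> nat \<Rightarrow> real" where
  "action_point hbar I n k = (if k = 1 then I else hbar * (real (n k) + 1/2))"

definition heaviside :: "real \<Rightarrow> real" where
  "heaviside t = (if t > 0 then 1 else 0)"

text \<open>The argument \<open>s\<close> is the sign in the index: \<open>s = 1\<close> for \<open>+\<close> and \<open>s = -1\<close> for \<open>-\<close>.\<close>

definition psi_out :: "real \<Rightarrow> real \<Rightarrow> real \<Rightarrow> real \<Rightarrow> complex" where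
  "psi_out hbar I s x =
     of_real (heaviside (s * x)) * of_real \<bar>x\<bar> powr (- 1/2 + \<i> * of_real (I / hbar))"

definition psi_in_integrand :: "real \<Rightarrow> real \<Rightarrow> real \<Rightarrow> real \<Rightarrow> real \<Rightarrow> complex" where
  "psi_in_integrand hbar I s x y =
     cnj (psi_out hbar I (- s) y) * exp (\<i> / of_real hbar * of_real x * of_real y)"

text \<open>The Henstock-Kurzweil integral over the whole line is the limit of the integrals over
  \<open>[a, b]\<close> as \<open>a\<close> and \<open>b\<close> tend independently to minus and plus infinity, so it covers the
  conditionally convergent integral here; the Lebesgue integral would not.\<close>

definition psi_in :: "real \<Rightarrow> real \<Rightarrow> real \<Rightarrow> real \<Rightarrow> complex" where
  "psi_in hbar I s x =
     1 / of_real (sqrt (2 * pi * hbar)) * integral UNIV (psi_in_integrand hbar I s x)"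

text \<open>The action \<open>I\<close> is complex here, so that the matrix can be considered as a meromorphic
  function of it. The energy and the mode enter only through \<open>I\<close>.\<close>

definition S_matrix :: "real \<Rightarrow> complex \<Rightarrow> complex^2^2" where
  "S_matrix hbar I =
     (let c = exp (\<i> * (of_real pi / 4 - I / of_real hbar * of_real (ln hbar)))
                / of_real (sqrt (2 * pi)) * Gamma (1/2 - \<i> * I / of_real hbar);
          r = - \<i> * exp (- of_real pi / 2 * I / of_real hbar);
          t = exp (of_real pi / 2 * I / of_real hbar)
      in vector [vector [c * r, c * t],
                 vector [c * t, c * r]])"

definition transmission_probability :: "complex^2^2 \<Rightarrow> real" where
  "transmission_probability S = (cmod (S $ 1 $ 2))\<^sup>2"

end

theory Submission
  imports Defs
begin

text \<open>Up to a reflection, the integral defining the incoming states is the Mellin transform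
  \<open>\<integral>\<^sub>0\<^sup>\<infinity> y\<^bsup>s-1\<^esup> e\<^bsup>-zy\<^esup> dy = z\<^bsup>-s\<^esup> \<Gamma>(s)\<close> at \<open>s = 1/2 - \<i> I / \<hbar>\<close> and a purely imaginary \<open>z\<close>. The lower
  incomplete Gamma function \<open>\<gamma>(s, w) = w\<^bsup>s\<^esup> \<Sum> (-w)\<^bsup>k\<^esup> / (k! (s + k))\<close> is a primitive of \<open>w\<^bsup>s-1\<^esup> e\<^bsup>-w\<^esup>\<close>,
  so the integral over \<open>[0, b]\<close> is \<open>z\<^bsup>-s\<^esup> \<gamma>(s, z b)\<close>. As \<open>b\<close> tends to infinity,
  \<open>\<gamma>(s, z b) - \<gamma>(s, b)\<close> vanishes for \<open>Re z \<ge> 0\<close> and \<open>0 < Re s < 1\<close>, while \<open>\<gamma>(s, b)\<close> tends to \<open>\<Gamma>(s)\<close> by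
  Euler's integral. The transmission probability follows from the reflection formula on the
  critical line, and the poles are those of \<open>\<Gamma>\<close>, because the other factors are entire and
  without zeros.\<close>

section \<open>Improper Henstock-Kurzweil integrals\<close>

text \<open>Integrals over unbounded sets are limits over boxes containing large balls; as soon as
  such a box reaches below \<open>a\<close>, the extension by zero makes its integral equal to
  \<open>F\<close> at the right end. Both directions serve later: one on Euler's integral, the other
  to obtain oscillatory integrals.\<close>

lemma has_integral_atLeast_iff_tendsto:
  fixes f :: "real \<Rightarrow> 'a::banach"
  assumes F: "\<And>b. a \<le> b \<Longrightarrow> (f has_integral F b) {a..b}"
  shows "(f has_integral L) {a..} \<longleftrightarrow> (F \<longlongrightarrow> L) at_top"
proof -
  let ?g = "\<lambda>x. if x \<in> {a..} then f x else 0"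
  have int: "?g integrable_on cbox c d" for c d
  proof -
    have "f integrable_on {max a c..d}"
      by (rule integrable_on_subinterval[OF has_integral_integrable[OF F[of "max a d"]]]) auto
    moreover have "{a..} \<inter> cbox c d = {max a c..d}" by auto
    ultimately show ?thesis by (simp only: integrable_restrict_Int)
  qed
  have val: "integral (cbox c d) ?g = F d" if "c \<le> a" "a \<le> d" for c d
  proof -
    have "{a..} \<inter> cbox c d = {a..d}" using that by auto
    then show ?thesis using F[OF that(2)] by (simp only: integral_restrict_Int integral_unique)
  qed
  have ball: "ball 0 B \<subseteq> cbox (- C) D" if "B \<le> C" "B \<le> D" for B C D :: real
    using that by (auto simp: dist_real_def)
  have bound: "c \<le> - r \<and> r \<le> d" if "ball 0 B \<subseteq> cbox c d" "0 < B" "r < B" "0 \<le> r" for B c d r :: real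
  proof -
    have "r \<in> ball 0 B" "- r \<in> ball 0 B" using that by (auto simp: dist_real_def)
    with that(1) have "r \<in> cbox c d" "- r \<in> cbox c d" by blast+
    then show ?thesis by auto
  qed
  show ?thesis
  proof
    assume L: "(f has_integral L) {a..}"
    show "(F \<longlongrightarrow> L) at_top"
    proof (rule tendstoI)
      fix e :: real assume "0 < e"
      with L obtain B where B: "0 < B" "\<And>c d. ball 0 B \<subseteq> cbox c d \<Longrightarrow> norm (integral (cbox c d) ?g - L) < e"
        unfolding has_integral_alt' by blast
      have "dist (F d) L < e" if "d \<ge> max B \<bar>a\<bar>" for d
        using B(2)[OF ball[of B "max B \<bar>a\<bar>" d]] val[of "- max B \<bar>a\<bar>" d] that
        by (auto simp: dist_norm)
      then show "\<forall>\<^sub>F d in at_top. dist (F d) L < e"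
        unfolding eventually_at_top_linorder by blast
    qed
  next
    assume L: "(F \<longlongrightarrow> L) at_top"
    show "(f has_integral L) {a..}"
      unfolding has_integral_alt'
    proof (intro conjI allI impI int)
      fix e :: real assume "0 < e"
      from tendstoD[OF L this] obtain N where N: "\<And>d. d \<ge> N \<Longrightarrow> dist (F d) L < e"
        unfolding eventually_at_top_linorder by blast
      \<comment> \<open>The balls are open, so a box containing the one of radius
        \<open>r + 1\<close> reaches at least from \<open>- r\<close> to \<open>r\<close>.\<close>
      define r where "r = max \<bar>a\<bar> \<bar>N\<bar>"
      have "norm (integral (cbox c d) ?g - L) < e" if "ball 0 (r + 1) \<subseteq> cbox c d" for c d
      proof -
        have "c \<le> a" "a \<le> d" "N \<le> d"
          using bound[OF that, of r] unfolding r_def by linarith+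
        then show ?thesis using val[of c d] N[of d] by (simp add: dist_norm)
      qed
      then show "\<exists>B>0. \<forall>c d. ball 0 B \<subseteq> cbox c d \<longrightarrow> norm (integral (cbox c d) ?g - L) < e"
        by (intro exI[of _ "r + 1"]) (auto simp: r_def)
    qed
  qed
qed

text \<open>Reflection preserves the boxes around a ball centred at 0, so the rule for compact
  intervals passes to the limit without absolute integrability.\<close>

lemma has_integral_reflect_UNIV:
  fixes f :: "real \<Rightarrow> 'a::banach"
  assumes "(f has_integral L) UNIV"
  shows "((\<lambda>x. f (- x)) has_integral L) UNIV"
proof -
  have f: "f integrable_on cbox a b" for a b
    using assms unfolding has_integral_alt' by simp
  have ball: "ball 0 B \<subseteq> cbox (- b) (- a)" if "ball 0 B \<subseteq> cbox a b" for B a b :: real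
  proof
    fix x :: real assume "x \<in> ball 0 B"
    then have "- x \<in> ball 0 B" by (simp add: dist_real_def)
    with that have "- x \<in> cbox a b" by blast
    then show "x \<in> cbox (- b) (- a)" by auto
  qed
  have int: "integral (cbox a b) (\<lambda>x. f (- x)) = integral (cbox (- b) (- a)) f" for a b
    using integral_reflect[of "- a" "- b" f] by simp
  show ?thesis
    unfolding has_integral_alt'
  proof (intro conjI allI impI)
    show "(\<lambda>x. if x \<in> UNIV then f (- x) else 0) integrable_on cbox a b" for a b
      using f[of "- b" "- a"] integrable_reflect[of f "- a" "- b"] by simp
    fix e :: real assume "0 < e"
    with assms obtain B where B: "0 < B" "\<And>a b. ball 0 B \<subseteq> cbox a b \<Longrightarrow> norm (integral (cbox a b) f - L) < e"
      unfolding has_integral_alt' by auto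
    show "\<exists>B>0. \<forall>a b. ball 0 B \<subseteq> cbox a b \<longrightarrow>
        norm (integral (cbox a b) (\<lambda>x. if x \<in> UNIV then f (- x) else 0) - L) < e"
      by (intro exI[of _ B] conjI allI impI B(1)) (simp only: UNIV_I if_True int B(2)[OF ball])
  qed
qed

section \<open>The lower incomplete Gamma function\<close>

text \<open>This factor is entire in \<open>w\<close> when \<open>Re s > 0\<close>. It is kept apart
  from \<open>w powr s\<close> because the endpoint \<open>w = 0\<close> lies on the branch cut of
  the power.\<close>

definition lower_gamma_series :: "complex \<Rightarrow> complex \<Rightarrow> complex" where
  "lower_gamma_series s w = suminf (\<lambda>k. (- 1) ^ k / (fact k * (s + of_nat k)) * w ^ k)"

definition lower_gamma :: "complex \<Rightarrow> complex \<Rightarrow> complex" where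
  "lower_gamma s w = w powr s * lower_gamma_series s w"

text \<open>Multiplying the k-th coefficient by \<open>s + of_nat k\<close> cancels its denominator,
  so the series \<open>P\<close> satisfies \<open>s * P w + w * P' w = exp (- w)\<close>; the
  product rule then gives the derivative.\<close>

lemma
  assumes s: "Re s > 0"
  shows isCont_lower_gamma_series:
      "isCont (lower_gamma_series s) w"
    and has_field_derivative_lower_gamma:
      "w \<notin> \<real>\<^sub>\<le>\<^sub>0 \<Longrightarrow> (lower_gamma s has_field_derivative w powr (s - 1) * exp (- w)) (at w)"
proof -
  let ?P = "lower_gamma_series s"
  define c :: "nat \<Rightarrow> complex" where "c k = (- 1) ^ k / (fact k * (s + of_nat k))" for k
  have nz: "s + of_nat k \<noteq> 0" for k
    using s by (auto simp: complex_eq_iff)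
  have summ: "summable (\<lambda>k. c k * z ^ k)" for z
  proof (rule summable_comparison_test)
    \<comment> \<open>Since \<open>Re s\<close> bounds the modulus of \<open>s + of_nat k\<close>
      from below, the exponential series dominates.\<close>
    have "norm (c k * z ^ k) \<le> norm z ^ k /\<^sub>R fact k * inverse (Re s)" for k
    proof -
      have "Re s \<le> cmod (s + of_nat k)"
        using complex_Re_le_cmod[of "s + of_nat k"] by simp
      then have "inverse (cmod (s + of_nat k)) \<le> inverse (Re s)"
        using s by (intro le_imp_inverse_le) auto
      then have "norm z ^ k / fact k * inverse (cmod (s + of_nat k)) \<le> norm z ^ k / fact k * inverse (Re s)"
        by (intro mult_left_mono) auto
      then show ?thesis by (simp add: c_def norm_mult norm_divide norm_power norm_inverse divide_inverse mult_ac)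
    qed
    then show "\<exists>N. \<forall>k\<ge>N. norm (c k * z ^ k) \<le> norm z ^ k /\<^sub>R fact k * inverse (Re s)" by blast
    show "summable (\<lambda>k. norm z ^ k /\<^sub>R fact k * inverse (Re s))"
      using summable_exp_generic[of "norm z"] by (intro summable_mult2)
  qed
  have P: "(?P has_field_derivative suminf (\<lambda>k. diffs c k * w ^ k)) (at w)" for w
    using termdiffs_strong_converges_everywhere[of c w, OF summ] by (simp add: c_def lower_gamma_series_def[abs_def])
  then show "isCont ?P w" for w by (rule DERIV_isCont)
  assume w: "w \<notin> \<real>\<^sub>\<le>\<^sub>0"
  then have w0: "w \<noteq> 0" by auto
  have 1: "(\<lambda>k. c k * w ^ k) sums ?P w"
    using summ[of w] by (simp add: c_def lower_gamma_series_def summable_sums)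
  have "(\<lambda>k. of_nat k * c k * w ^ (k - 1)) sums suminf (\<lambda>k. diffs c k * w ^ k)"
    using diffs_equiv[OF termdiff_converges_all[OF summ], of w] by simp
  then have 2: "(\<lambda>k. w * (of_nat k * c k * w ^ (k - 1))) sums (w * suminf (\<lambda>k. diffs c k * w ^ k))"
    by (rule sums_mult)
  have "(\<lambda>k. s * (c k * w ^ k) + w * (of_nat k * c k * w ^ (k - 1))) sums
      (s * ?P w + w * suminf (\<lambda>k. diffs c k * w ^ k))"
    by (rule sums_add[OF sums_mult[OF 1] 2])
  also have "(\<lambda>k. s * (c k * w ^ k) + w * (of_nat k * c k * w ^ (k - 1))) = (\<lambda>k. (- w) ^ k /\<^sub>R fact k)"
  proof
    fix k
    \<comment> \<open>The case \<open>k = 0\<close> is separate because there \<open>k - 1\<close>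
      is truncated to 0; the factor \<open>of_nat k\<close> kills that term.\<close>
    have "s * (c k * w ^ k) + w * (of_nat k * c k * w ^ (k - 1)) = (s + of_nat k) * c k * w ^ k"
      by (cases k) (simp_all add: algebra_simps)
    also have "\<dots> = (- w) ^ k /\<^sub>R fact k"
    proof -
      have "(s + of_nat k) * c k = (- 1) ^ k / fact k"
        using nz[of k] by (simp add: c_def)
      then show ?thesis
        by (simp add: scaleR_conv_of_real power_minus[of w] divide_inverse mult_ac)
    qed
    finally show "s * (c k * w ^ k) + w * (of_nat k * c k * w ^ (k - 1)) = (- w) ^ k /\<^sub>R fact k" .
  qed
  finally have eq: "s * ?P w + w * suminf (\<lambda>k. diffs c k * w ^ k) = exp (- w)"
    by (rule sums_unique2) (rule exp_converges)
  have "((\<lambda>w. w powr s * ?P w) has_field_derivative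
      s * w powr (s - 1) * ?P w + suminf (\<lambda>k. diffs c k * w ^ k) * w powr s) (at w)"
    by (rule DERIV_mult[OF has_field_derivative_powr[OF w] P])
  also have "w powr s = w powr (s - 1) * w"
    using w0 by (simp add: powr_diff)
  also have "s * w powr (s - 1) * ?P w + suminf (\<lambda>k. diffs c k * w ^ k) * (w powr (s - 1) * w) =
      w powr (s - 1) * exp (- w)"
    unfolding eq[symmetric] by (simp add: algebra_simps)
  finally show "(lower_gamma s has_field_derivative w powr (s - 1) * exp (- w)) (at w)"
    by (simp add: lower_gamma_def[abs_def])
qed

text \<open>The integrand may be singular at 0, so the fundamental theorem is applied with a
  primitive that is continuous on the closed interval and differentiable only inside.\<close>

lemma has_integral_lower_gamma:
  assumes s: "Re s > 0" and z: "z \<notin> \<real>\<^sub>\<le>\<^sub>0" and b: "0 \<le> b"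
  shows "((\<lambda>y. of_real y powr (s - 1) * exp (- z * of_real y)) has_integral
           z powr (- s) * lower_gamma s (z * of_real b)) {0..b}"
proof -
  let ?P = "lower_gamma_series s"
  \<comment> \<open>The primitive with \<open>z powr s\<close> cancelled: in this form it is
    continuous at 0, where its value is 0.\<close>
  let ?G = "\<lambda>y::real. of_real y powr s * ?P (z * of_real y)"
  have z0: "z \<noteq> 0" using z by auto
  \<comment> \<open>The power splits without a branch correction because \<open>y\<close> is real
    and nonnegative.\<close>
  have pw: "(z * of_real y) powr t = of_real y powr t * z powr t" if "0 \<le> y" for y t
    using that powr_times_real_left[of "of_real y" z t] by (simp add: mult.commute)
  have zy: "z powr (- s) * lower_gamma s (z * of_real y) = ?G y" if "0 \<le> y" for y
    using z0 by (simp add: lower_gamma_def pw[OF that] powr_minus)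
  have "((\<lambda>y. of_real y powr (s - 1) * exp (- z * of_real y)) has_integral ?G b - ?G 0) {0..b}"
  proof (rule fundamental_theorem_of_calculus_interior[OF b])
    have "isCont (\<lambda>y. ?P (z * of_real y)) y" for y :: real
      by (rule isCont_o2[where f = "\<lambda>y. z * of_real y", OF _ isCont_lower_gamma_series[OF s]])
        (intro continuous_intros)
    then have "continuous_on {0..b} (\<lambda>y. ?P (z * of_real y))"
      by (simp add: continuous_at_imp_continuous_on)
    then show "continuous_on {0..b} ?G"
      using s by (intro continuous_on_mult continuous_on_powr_complex continuous_intros) auto
  next
    fix y assume y: "y \<in> {0<..<b}"
    have zy': "z * of_real y \<notin> \<real>\<^sub>\<le>\<^sub>0"
      using z y by (auto simp: complex_nonpos_Reals_iff mult_le_0_iff)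
    have "((\<lambda>y. z powr (- s) * lower_gamma s (z * of_real y)) has_vector_derivative
        z powr (- s) * ((z * of_real y) powr (s - 1) * exp (- (z * of_real y)) * z)) (at y)"
    proof -
      have "((\<lambda>w. z powr (- s) * lower_gamma s (z * w)) has_field_derivative
        z powr (- s) * ((z * of_real y) powr (s - 1) * exp (- (z * of_real y)) * z)) (at (of_real y))"
        by (intro DERIV_cmult DERIV_chain2[where g = "(*) z", OF has_field_derivative_lower_gamma[OF s zy']])
          (auto intro!: derivative_eq_intros)
      from has_vector_derivative_real_field[OF this] show ?thesis .
    qed
    also have "z powr (- s) * ((z * of_real y) powr (s - 1) * exp (- (z * of_real y)) * z) =
        of_real y powr (s - 1) * exp (- z * of_real y)"
    proof -
      have "z powr (- s) * (z * z powr (s - 1)) = 1"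
        using z0 by (simp add: powr_minus powr_diff)
      then have "of_real y powr (s - 1) * exp (- z * of_real y) =
          z powr (- s) * (z * z powr (s - 1)) * (of_real y powr (s - 1) * exp (- z * of_real y))"
        by simp
      then show ?thesis using y by (simp add: pw mult_ac)
    qed
    finally show "(?G has_vector_derivative of_real y powr (s - 1) * exp (- z * of_real y)) (at y)"
      by (rule has_vector_derivative_transform_within_open[of _ _ _ "{0<..}"])
        (use y zy in \<open>auto simp: less_imp_le\<close>)
  qed
  then show ?thesis using zy[OF b] by simp
qed

section \<open>Limits along rays and the Mellin transform\<close>

lemma tendsto_lower_gamma:
  assumes s: "Re s > 0"
  shows "((\<lambda>b. lower_gamma s (of_real b)) \<longlongrightarrow> Gamma s) at_top"
proof -
  have "((\<lambda>y. of_real y powr (s - 1) * exp (- 1 * of_real y)) has_integral Gamma s) {0..}"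
    using Gamma_integral_complex[OF s] by (simp add: exp_minus divide_inverse exp_of_real)
  then show ?thesis
    using has_integral_atLeast_iff_tendsto[OF has_integral_lower_gamma[OF s, of 1]] by simp
qed

text \<open>The limit does not depend on the direction \<open>z\<close>: along the segment from \<open>b\<close> to \<open>z * b\<close> the
  integrand is \<open>O(b powr (Re s - 1) * exp (- b * (1 - t)))\<close>, and the factor \<open>b\<close> from the length of the
  segment is absorbed by integrating the exponential.\<close>

lemma tendsto_lower_gamma_mult:
  assumes s: "0 < Re s" "Re s < 1" and z: "0 \<le> Re z" "z \<noteq> 0"
  shows "((\<lambda>b. lower_gamma s (z * of_real b)) \<longlongrightarrow> Gamma s) at_top"
proof -
  \<comment> \<open>The segment from 1 to \<open>z\<close>. It avoids 0 because \<open>Re z\<close>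
    is nonnegative and \<open>z\<close> is nonzero.\<close>
  let ?p = "\<lambda>t::real. 1 - of_real t + z * of_real t :: complex"
  have p0: "?p t \<noteq> 0" if "0 \<le> t" "t \<le> 1" for t
  proof
    assume "?p t = 0"
    then have "(1 - t) + Re z * t = 0" "Im z * t = 0" by (auto simp: complex_eq_iff)
    moreover have "0 \<le> Re z * t" using z that by simp
    ultimately have "t = 1" using that by linarith
    then show False using z \<open>?p t = 0\<close> by simp
  qed
  \<comment> \<open>By compactness the segment keeps a distance \<open>m\<close> from 0; as
    \<open>Re s - 1\<close> is negative, this bounds the power from above.\<close>
  obtain m where m: "m > 0" "\<And>t. 0 \<le> t \<Longrightarrow> t \<le> 1 \<Longrightarrow> m \<le> cmod (?p t)"
  proof -
    have "\<exists>x\<in>{0..1}. \<forall>t\<in>{0..1}. cmod (?p x) \<le> cmod (?p t)"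
      by (intro continuous_attains_inf continuous_intros) auto
    then obtain x where x: "x \<in> {0..1}" "\<forall>t\<in>{0..1}. cmod (?p x) \<le> cmod (?p t)" by blast
    show thesis by (rule that[of "cmod (?p x)"]) (use x p0[of x] in auto)
  qed
  \<comment> \<open>The last factor absorbs the argument's contribution to the modulus of a complex
    power, as \<open>Arg\<close> is at most \<open>pi\<close> in modulus.\<close>
  define C where "C = cmod (z - 1) * m powr (Re s - 1) * exp (\<bar>Im s\<bar> * pi)"
  have bound: "norm (lower_gamma s (z * of_real b) - lower_gamma s (of_real b)) \<le> C * b powr (Re s - 1)"
    if b: "b > 0" for b
  proof -
    let ?w = "\<lambda>t::real. of_real b * ?p t"
    let ?f' = "\<lambda>t. of_real b * (z - 1) * (?w t powr (s - 1) * exp (- ?w t))"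
    \<comment> \<open>Its derivative is \<open>b\<close> times itself and dominates the integrand
      along the segment; this is how the factor \<open>b\<close> is absorbed.\<close>
    let ?\<phi> = "\<lambda>t. C * b powr (Re s - 1) * exp (- b * (1 - t))"
    have w: "?w t \<notin> \<real>\<^sub>\<le>\<^sub>0" if "0 \<le> t" "t \<le> 1" for t
    proof -
      have "0 \<le> Re z * t" using z that by simp
      then have "Re (?p t) \<ge> 0" using that by simp
      then show ?thesis
        using p0[OF that] b by (auto simp: complex_nonpos_Reals_iff complex_eq_iff mult_le_0_iff)
    qed
    have f': "((\<lambda>t. lower_gamma s (?w t)) has_vector_derivative ?f' t) (at t)"
      if "0 \<le> t" "t \<le> 1" for t
    proof -
      have "((\<lambda>t. lower_gamma s (of_real b * (1 - t + z * t))) has_field_derivative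
          (?w t powr (s - 1) * exp (- ?w t)) * (of_real b * (z - 1))) (at (of_real t))"
        by (rule DERIV_chain2[where g = "\<lambda>t. of_real b * (1 - t + z * t)",
              OF has_field_derivative_lower_gamma[OF s(1)]])
          (use w[OF that] in \<open>auto intro!: derivative_eq_intros\<close>)
      from has_vector_derivative_real_field[OF this] show ?thesis by (simp add: mult_ac)
    qed
    have "norm (lower_gamma s (?w 1) - lower_gamma s (?w 0)) \<le> ?\<phi> 1 - ?\<phi> 0"
    proof (rule differentiable_bound_general[where f' = ?f' and \<phi>' = "\<lambda>t. b * ?\<phi> t"])
      show "continuous_on {0..1} (\<lambda>t. lower_gamma s (?w t))"
        using f' by (intro continuous_at_imp_continuous_on ballI)
          (auto intro: has_vector_derivative_continuous)
      show "continuous_on {0..1} ?\<phi>" by (intro continuous_intros)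
      fix t :: real assume t: "0 < t" "t < 1"
      show "((\<lambda>t. lower_gamma s (?w t)) has_vector_derivative ?f' t) (at t)"
        using f' t by simp
      show "(?\<phi> has_vector_derivative b * ?\<phi> t) (at t)"
        unfolding has_real_derivative_iff_has_vector_derivative[symmetric]
        by (auto intro!: derivative_eq_intros)
      have nw: "b * m \<le> cmod (?w t)"
        using m(2)[of t] t b by (simp add: norm_mult)
      have "cmod (?w t powr (s - 1)) \<le> cmod (?w t) powr (Re s - 1) * exp (\<bar>Im s\<bar> * pi)"
      proof -
        have "- Im s * Arg (?w t) \<le> \<bar>Im s\<bar> * \<bar>Arg (?w t)\<bar>"
          by (metis abs_ge_self abs_minus_cancel abs_mult)
        also have "\<dots> \<le> \<bar>Im s\<bar> * pi"
          using Arg_bounded[of "?w t"] by (intro mult_left_mono) auto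
        finally show ?thesis
          unfolding norm_powr_complex by (intro mult_mono) auto
      qed
      also have "\<dots> \<le> (b * m) powr (Re s - 1) * exp (\<bar>Im s\<bar> * pi)"
        using nw b m s by (intro mult_right_mono powr_mono2') auto
      finally have 1: "cmod (?w t powr (s - 1)) \<le> b powr (Re s - 1) * m powr (Re s - 1) * exp (\<bar>Im s\<bar> * pi)"
        using b m by (simp add: powr_mult)
      \<comment> \<open>The real part of \<open>?p t\<close> is at least \<open>1 - t\<close>, since
        \<open>Re z\<close> is nonnegative.\<close>
      have 2: "cmod (exp (- ?w t)) \<le> exp (- b * (1 - t))"
        using z t b by simp
      have "cmod (?f' t) = b * cmod (z - 1) * (cmod (?w t powr (s - 1)) * cmod (exp (- ?w t)))"
        using b by (simp add: norm_mult)
      also have "\<dots> \<le> b * cmod (z - 1) * ((b powr (Re s - 1) * m powr (Re s - 1) * exp (\<bar>Im s\<bar> * pi)) * exp (- b * (1 - t)))"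
        using 1 2 b by (intro mult_left_mono mult_mono) auto
      also have "\<dots> = b * ?\<phi> t" by (simp add: C_def mult_ac)
      finally show "cmod (?f' t) \<le> b * ?\<phi> t" .
    qed simp
    also have "\<dots> \<le> C * b powr (Re s - 1)"
      by (simp add: C_def)
    finally show ?thesis by (simp add: mult.commute)
  qed
  have "((\<lambda>b. C * b powr (Re s - 1)) \<longlongrightarrow> C * 0) at_top"
    using s by (intro tendsto_mult tendsto_const tendsto_neg_powr filterlim_ident) auto
  then have "((\<lambda>b. lower_gamma s (z * of_real b) - lower_gamma s (of_real b)) \<longlongrightarrow> 0) at_top"
    by (intro Lim_null_comparison[OF eventually_mono[OF eventually_gt_at_top[of 0] bound]]) simp_all
  from tendsto_add[OF this tendsto_lower_gamma[OF s(1)]] show ?thesis by simp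
qed

text \<open>The case \<open>Re z = 0\<close> is the one needed; convergence is then only conditional
  and rests on \<open>Re s < 1\<close>.\<close>

lemma has_integral_powr_mult_exp_Gamma:
  assumes s: "0 < Re s" "Re s < 1" and z: "0 \<le> Re z" "z \<noteq> 0"
  shows "((\<lambda>y. of_real y powr (s - 1) * exp (- z * of_real y)) has_integral
           z powr (- s) * Gamma s) {0..}"
proof -
  have "z \<notin> \<real>\<^sub>\<le>\<^sub>0" using z by (auto simp: complex_nonpos_Reals_iff complex_eq_iff)
  moreover have "((\<lambda>b. z powr (- s) * lower_gamma s (z * of_real b)) \<longlongrightarrow> z powr (- s) * Gamma s) at_top"
    by (intro tendsto_mult tendsto_const tendsto_lower_gamma_mult s z)
  ultimately show ?thesis
    using has_integral_atLeast_iff_tendsto[OF has_integral_lower_gamma[OF s(1), of z]] by simp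
qed

section \<open>Incoming states at real action\<close>

text \<open>The integrand lives on the half-line opposite to the sign \<sigma>. Replacing
  \<open>y\<close> by \<open>- \<sigma> * y\<close> moves it to the positive axis, where it is a
  Mellin integrand with purely imaginary \<open>z\<close>; conjugation turns the exponent into
  \<open>s - 1\<close>.\<close>

lemma has_integral_psi_in_integrand:
  fixes \<sigma> x hbar I :: real
  assumes sgn: "\<sigma> \<in> {1, - 1}" and x: "x \<noteq> 0" and hbar: "hbar > 0"
  defines "s \<equiv> 1 / 2 - \<i> * of_real (I / hbar)"
  shows "(psi_in_integrand hbar I \<sigma> x has_integral
           (\<i> * of_real (\<sigma> * x / hbar)) powr (- s) * Gamma s) UNIV"
proof -
  let ?z = "\<i> * of_real (\<sigma> * x / hbar)"
  define g where "g = (\<lambda>y. if y \<in> {0..} then of_real y powr (s - 1) * exp (- ?z * of_real y) else 0)"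
  have "((\<lambda>y. of_real y powr (s - 1) * exp (- ?z * of_real y)) has_integral ?z powr (- s) * Gamma s) {0..}"
    using sgn x hbar by (intro has_integral_powr_mult_exp_Gamma) (auto simp: s_def)
  then have g: "(g has_integral ?z powr (- s) * Gamma s) UNIV"
    by (simp only: g_def has_integral_restrict_UNIV)
  have cnj: "cnj (of_real \<bar>y\<bar> powr (- 1 / 2 + \<i> * of_real (I / hbar))) = of_real \<bar>y\<bar> powr (s - 1)" for y
  proof -
    have "cnj (- 1 / 2 + \<i> * of_real (I / hbar)) = s - 1"
      by (simp add: s_def complex_eq_iff)
    then show ?thesis by (subst cnj_powr) simp_all
  qed
  \<comment> \<open>This includes \<open>y = 0\<close>, where both sides vanish because
    \<open>0 powr (s - 1) = 0\<close>.\<close>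
  have "psi_in_integrand hbar I \<sigma> x y = g (- \<sigma> * y)" for y
    unfolding psi_in_integrand_def psi_out_def complex_cnj_mult cnj
    using sgn by (auto simp: g_def heaviside_def field_simps)
  then have eq: "psi_in_integrand hbar I \<sigma> x = (\<lambda>y. g (- \<sigma> * y))" by blast
  from sgn consider "\<sigma> = 1" | "\<sigma> = - 1" by blast
  then show ?thesis
  proof cases
    case 1
    then show ?thesis using has_integral_reflect_UNIV[OF g] unfolding eq by simp
  next
    case 2
    then show ?thesis using g unfolding eq by simp
  qed
qed

text \<open>The entries without their Gamma factor: entire and free of zeros for positive
  \<open>hbar\<close>, so that Gamma alone decides the poles.\<close>

definition S_factor :: "real \<Rightarrow> bool \<Rightarrow> complex \<Rightarrow> complex" where
  "S_factor hbar diag I =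
     exp (\<i> * (of_real pi / 4 - I / of_real hbar * of_real (ln hbar))) / of_real (sqrt (2 * pi)) *
     (if diag then - \<i> * exp (- of_real pi / 2 * I / of_real hbar)
      else exp (of_real pi / 2 * I / of_real hbar))"

lemma S_matrix_nth:
  "S_matrix hbar I $ i $ j = S_factor hbar (i = j) I * Gamma (1/2 - \<i> * I / of_real hbar)"
proof -
  have "\<forall>i j. S_matrix hbar I $ i $ j = S_factor hbar (i = j) I * Gamma (1/2 - \<i> * I / of_real hbar)"
    unfolding forall_2 S_matrix_def S_factor_def Let_def by simp
  then show ?thesis by blast
qed

text \<open>In the power with exponent \<open>- s\<close>, the modulus of the base gives the
  dependence on \<open>x\<close> and a power of \<open>hbar\<close>, while its argument, plus or
  minus \<open>pi / 2\<close>, gives the constants that distinguish diagonal from off-diagonal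
  entries.\<close>

lemma psi_in_eq:
  assumes sgn: "\<sigma> \<in> {1, - 1}" and x: "x \<noteq> 0" and hbar: "hbar > 0"
  shows "psi_in hbar I \<sigma> x = S_factor hbar (\<sigma> * x > 0) (of_real I) *
     Gamma (1/2 - \<i> * of_real I / of_real hbar) * of_real \<bar>x\<bar> powr (- 1/2 + \<i> * of_real (I / hbar))"
proof -
  define s where "s = 1 / 2 - \<i> * of_real (I / hbar)"
  define u where "u = \<sigma> * x"
  have u: "u \<noteq> 0" "\<bar>u\<bar> = \<bar>x\<bar>" using sgn x by (auto simp: u_def)
  \<comment> \<open>Minus the sign of \<open>u\<close>, so the logarithm has imaginary part
    \<open>- d * pi / 2\<close>.\<close>
  define d where "d = (if u > 0 then - 1 else 1 :: complex)"
  have "\<i> * of_real (u / hbar) = of_real (\<bar>u\<bar> / hbar) * (- d * \<i>)"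
    using u(1) by (auto simp: d_def)
  also have "Ln \<dots> = of_real (ln (\<bar>u\<bar> / hbar)) + Ln (- d * \<i>)"
    using u hbar by (subst Ln_times_of_real) (auto simp: d_def Ln_of_real simp del: of_real_divide)
  also have "Ln (- d * \<i>) = - d * (\<i> * of_real pi / 2)"
    by (auto simp: d_def)
  finally have Ln: "Ln (\<i> * of_real (u / hbar)) = of_real (ln \<bar>x\<bar> - ln hbar) - d * (\<i> * of_real pi / 2)"
    using u hbar x by (simp add: ln_div)
  have "(\<i> * of_real (u / hbar)) powr (- s) =
      exp (- s * of_real (ln \<bar>x\<bar>)) * exp (s * of_real (ln hbar)) * exp (s * d * (\<i> * of_real pi / 2))"
    using u hbar by (simp add: powr_def Ln exp_add[symmetric] algebra_simps del: of_real_divide)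
  \<comment> \<open>The factor \<open>sqrt hbar\<close> will cancel the one in the normalisation of
    \<open>psi_in\<close>.\<close>
  also have "exp (s * of_real (ln hbar)) = of_real (sqrt hbar) * exp (- \<i> * of_real (I / hbar) * of_real (ln hbar))"
  proof -
    have "s * of_real (ln hbar) = of_real (ln (sqrt hbar)) + (- \<i> * of_real (I / hbar) * of_real (ln hbar))"
      using hbar by (simp add: s_def ln_sqrt algebra_simps)
    also have "exp \<dots> = of_real (sqrt hbar) * exp (- \<i> * of_real (I / hbar) * of_real (ln hbar))"
      unfolding exp_add exp_of_real using hbar by simp
    finally show ?thesis .
  qed
  also have "exp (s * d * (\<i> * of_real pi / 2)) =
      exp (\<i> * of_real pi / 4) * (if u > 0 then - \<i> * exp (- of_real pi / 2 * of_real (I / hbar))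
        else exp (of_real pi / 2 * of_real (I / hbar)))"
  proof (cases "u > 0")
    case True
    have "s * d * (\<i> * of_real pi / 2) =
        \<i> * of_real pi / 4 + (- (of_real pi / 2 * \<i>)) + (- of_real pi / 2 * of_real (I / hbar))"
      using True by (simp add: s_def d_def algebra_simps)
    also have "exp \<dots> = exp (\<i> * of_real pi / 4) * (- \<i> * exp (- of_real pi / 2 * of_real (I / hbar)))"
    proof -
      have "exp (- (of_real pi / 2 * \<i>)) = - \<i>"
        using cis_conv_exp[of "- (pi / 2)"] by (simp add: mult.commute complex_eq_iff)
      then show ?thesis by (simp only: exp_add mult.assoc)
    qed
    finally show ?thesis by (simp only: True if_True)
  next
    case False
    then have "s * d * (\<i> * of_real pi / 2) = \<i> * of_real pi / 4 + of_real pi / 2 * of_real (I / hbar)"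
      by (simp add: s_def d_def algebra_simps)
    then show ?thesis using False by (simp only: exp_add if_False)
  qed
  also have "exp (- s * of_real (ln \<bar>x\<bar>)) = of_real \<bar>x\<bar> powr (- 1/2 + \<i> * of_real (I / hbar))"
    using x by (simp add: powr_def s_def Ln_of_real)
  finally have *: "(\<i> * of_real (u / hbar)) powr (- s) = of_real \<bar>x\<bar> powr (- 1/2 + \<i> * of_real (I / hbar)) *
      (of_real (sqrt hbar) * exp (- \<i> * of_real (I / hbar) * of_real (ln hbar))) *
      (exp (\<i> * of_real pi / 4) * (if u > 0 then - \<i> * exp (- of_real pi / 2 * of_real (I / hbar))
        else exp (of_real pi / 2 * of_real (I / hbar))))" .
  have e: "exp (- \<i> * of_real (I / hbar) * of_real (ln hbar)) * exp (\<i> * of_real pi / 4) =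
      exp (\<i> * (of_real pi / 4 - of_real I / of_real hbar * of_real (ln hbar)))"
    by (simp add: exp_add[symmetric] algebra_simps)
  have q: "1 / of_real (sqrt (2 * pi * hbar)) * of_real (sqrt hbar) = 1 / complex_of_real (sqrt (2 * pi))"
    using hbar by (simp add: real_sqrt_mult)
  have s': "s = 1/2 - \<i> * of_real I / of_real hbar"
    by (simp add: s_def)
  have r: "c * of_real (I / hbar) = c * of_real I / of_real hbar" for c :: complex
    by simp
  have S_factor: "S_factor hbar (u > 0) (of_real I) = 1 / of_real (sqrt (2 * pi)) *
      exp (\<i> * (of_real pi / 4 - of_real I / of_real hbar * of_real (ln hbar))) *
      (if u > 0 then - \<i> * exp (- of_real pi / 2 * of_real (I / hbar))
        else exp (of_real pi / 2 * of_real (I / hbar)))"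
    unfolding S_factor_def r by (simp only: mult_1 times_divide_eq_left)
  have "psi_in hbar I \<sigma> x = 1 / of_real (sqrt (2 * pi * hbar)) * ((\<i> * of_real (u / hbar)) powr (- s) * Gamma s)"
    unfolding psi_in_def s_def u_def
    by (simp only: integral_unique[OF has_integral_psi_in_integrand[OF sgn x hbar]])
  also have "\<dots> = (1 / of_real (sqrt (2 * pi * hbar)) * of_real (sqrt hbar)) *
      (exp (- \<i> * of_real (I / hbar) * of_real (ln hbar)) * exp (\<i> * of_real pi / 4)) *
      (if u > 0 then - \<i> * exp (- of_real pi / 2 * of_real (I / hbar))
        else exp (of_real pi / 2 * of_real (I / hbar))) * Gamma s * of_real \<bar>x\<bar> powr (- 1/2 + \<i> * of_real (I / hbar))"
    unfolding * by (simp only: mult_ac)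
  finally show ?thesis
    unfolding q e u_def[symmetric] S_factor s' .
qed

section \<open>Transmission probability\<close>

text \<open>On the critical line \<open>1 - z\<close> is the conjugate of \<open>z\<close>, so the
  squared modulus is the product in the reflection formula.\<close>

lemma norm_Gamma_half_squared:
  "(cmod (Gamma (1/2 - \<i> * of_real t)))\<^sup>2 = pi / cosh (pi * t)"
proof -
  let ?z = "1/2 - \<i> * of_real t"
  have "complex_of_real ((cmod (Gamma ?z))\<^sup>2) = Gamma ?z * Gamma (1 - ?z)"
    unfolding complex_norm_square by (simp add: cnj_Gamma)
  also have "\<dots> = of_real pi / sin (of_real pi / 2 - \<i> * of_real (pi * t))"
    unfolding Gamma_reflection_complex by (simp add: algebra_simps)
  also have "sin (of_real pi / 2 - \<i> * of_real (pi * t)) = cosh (complex_of_real (pi * t))"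
    by (simp only: cos_sin_eq[symmetric] cosh_conv_cos)
  also have "\<dots> = of_real (cosh (pi * t))"
    by (simp add: cosh_field_def exp_of_real[symmetric])
  also have "of_real pi / complex_of_real (cosh (pi * t)) = of_real (pi / cosh (pi * t))"
    by simp
  finally show ?thesis unfolding of_real_eq_iff .
qed

lemma transmission_probability_S_matrix:
  assumes hbar: "hbar > 0"
  shows "transmission_probability (S_matrix hbar (of_real I)) = inverse (1 + exp (- 2 * pi * I / hbar))"
proof -
  let ?t = "I / hbar"
  have "cmod (S_factor hbar False (of_real I)) = exp (pi / 2 * ?t) / sqrt (2 * pi)"
    by (simp add: S_factor_def norm_mult norm_divide)
  then have "transmission_probability (S_matrix hbar (of_real I)) =
      (exp (pi / 2 * ?t) / sqrt (2 * pi))\<^sup>2 * (pi / cosh (pi * ?t))"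
    unfolding transmission_probability_def
    using norm_Gamma_half_squared[of ?t] by (simp add: S_matrix_nth norm_mult power_mult_distrib power_divide)
  also have "(exp (pi / 2 * ?t) / sqrt (2 * pi))\<^sup>2 = exp (pi * ?t) / (2 * pi)"
    by (simp add: power_divide exp_of_nat_mult[symmetric] flip: exp_double)
  also have "exp (pi * ?t) / (2 * pi) * (pi / cosh (pi * ?t)) = exp (pi * ?t) / (exp (pi * ?t) + exp (- (pi * ?t)))"
    by (simp add: cosh_field_def)
  also have "\<dots> = 1 / (1 + exp (- (pi * ?t)) / exp (pi * ?t))"
    by (simp add: divide_simps add_pos_pos)
  also have "exp (- (pi * ?t)) / exp (pi * ?t) = exp (- 2 * pi * I / hbar)"
    by (simp add: exp_diff[symmetric])
  finally show ?thesis by (simp add: inverse_eq_divide)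
qed

section \<open>Meromorphy and poles in the complex action\<close>

lemma analytic_S_factor: "hbar > 0 \<Longrightarrow> S_factor hbar d analytic_on A"
  unfolding S_factor_def[abs_def] by (cases d) (auto intro!: analytic_intros)

lemma S_factor_nonzero: "S_factor hbar d z \<noteq> 0"
  by (simp add: S_factor_def)

text \<open>Gamma is the reciprocal of the entire function \<open>rGamma\<close>.\<close>

lemma meromorphic_S_matrix_nth:
  assumes "hbar > 0"
  shows "(\<lambda>z. S_matrix hbar z $ i $ j) meromorphic_on A"
proof -
  have "(\<lambda>z. rGamma (1/2 - \<i> * z / of_real hbar)) analytic_on A"
    by (rule analytic_on_compose_gen[of _ _ rGamma UNIV, unfolded o_def])
      (use assms in \<open>auto intro!: analytic_intros analytic_rGamma\<close>)
  then have "(\<lambda>z. S_factor hbar (i = j) z * inverse (rGamma (1/2 - \<i> * z / of_real hbar))) meromorphic_on A"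
    by (intro meromorphic_intros analytic_on_imp_meromorphic_on analytic_S_factor assms)
  then show ?thesis by (simp add: S_matrix_nth Gamma_def)
qed

text \<open>A pole of the matrix means that its norm tends to infinity. One divergent entry
  suffices, as it bounds the norm from below; away from the poles of Gamma all entries have finite
  limits.\<close>

lemma is_pole_S_matrix_iff:
  assumes hbar: "hbar > 0"
  shows "is_pole (S_matrix hbar) z \<longleftrightarrow> 1/2 - \<i> * z / of_real hbar \<in> \<int>\<^sub>\<le>\<^sub>0"
proof
  assume "1/2 - \<i> * z / of_real hbar \<in> \<int>\<^sub>\<le>\<^sub>0"
  then obtain n where n: "1/2 - \<i> * z / of_real hbar = - of_nat n" by (elim nonpos_Ints_cases')
  have "is_pole (\<lambda>z. Gamma (1/2 - \<i> * z / of_real hbar)) z"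
  proof (rule is_pole_compose[OF is_pole_Gamma[of n]])
    show "((\<lambda>z. 1/2 - \<i> * z / of_real hbar) \<longlongrightarrow> - of_nat n) (at z)"
      using isContD[of z "\<lambda>z. 1/2 - \<i> * z / of_real hbar"] hbar by (simp add: n)
    \<comment> \<open>The affine map is injective, so only \<open>z\<close> itself reaches the pole
      of Gamma.\<close>
    have "1/2 - \<i> * w / of_real hbar \<noteq> - of_nat n" if "w \<noteq> z" for w
      unfolding n[symmetric] using that hbar by simp
    then show "\<forall>\<^sub>F w in at z. 1/2 - \<i> * w / of_real hbar \<noteq> - of_nat n"
      by (simp add: eventually_at_filter)
  qed
  then have "is_pole (\<lambda>z. S_matrix hbar z $ 1 $ 1) z"
    unfolding S_matrix_nth
    by (rule is_pole_mult_analytic_nonzero1[OF _ analytic_S_factor[OF hbar] S_factor_nonzero])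
  then have "filterlim (\<lambda>z. norm (S_matrix hbar z $ 1 $ 1)) at_top (at z)"
    unfolding is_pole_def filterlim_at_infinity_conv_norm_at_top .
  moreover have "\<forall>\<^sub>F w in at z. norm (S_matrix hbar w $ 1 $ 1) \<le> norm (S_matrix hbar w)"
    by (intro always_eventually allI order_trans[OF Finite_Cartesian_Product.norm_nth_le Finite_Cartesian_Product.norm_nth_le])
  ultimately show "is_pole (S_matrix hbar) z"
    unfolding is_pole_def filterlim_at_infinity_conv_norm_at_top
    by (rule filterlim_at_top_mono)
next
  assume pole: "is_pole (S_matrix hbar) z"
  show "1/2 - \<i> * z / of_real hbar \<in> \<int>\<^sub>\<le>\<^sub>0"
  proof (rule ccontr)
    assume z: "1/2 - \<i> * z / of_real hbar \<notin> \<int>\<^sub>\<le>\<^sub>0"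
    have "((\<lambda>w. S_matrix hbar w $ i $ j) \<longlongrightarrow> S_matrix hbar z $ i $ j) (at z)" for i j
    proof -
      have "isCont (S_factor hbar (i = j)) z"
        by (intro analytic_at_imp_isCont analytic_S_factor hbar)
      then have "(S_factor hbar (i = j) \<longlongrightarrow> S_factor hbar (i = j) z) (at z)"
        by (rule isContD)
      moreover have "((\<lambda>w. Gamma (1/2 - \<i> * w / of_real hbar)) \<longlongrightarrow> Gamma (1/2 - \<i> * z / of_real hbar)) (at z)"
        by (intro tendsto_Gamma z tendsto_intros) (use hbar in auto)
      ultimately show ?thesis unfolding S_matrix_nth by (rule tendsto_mult)
    qed
    then have "(S_matrix hbar \<longlongrightarrow> S_matrix hbar z) (at z)"
      by (intro vec_tendstoI)
    from not_tendsto_and_filterlim_at_infinity[OF at_neq_bot this pole[unfolded is_pole_def]]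
    show False .
  qed
qed

lemma poles_S_matrix:
  assumes hbar: "hbar > 0"
  shows "{z. is_pole (S_matrix hbar) z} = range (\<lambda>n::nat. - \<i> * of_real (hbar * (real n + 1/2)))"
proof -
  have "1/2 - \<i> * z / of_real hbar = - of_nat n \<longleftrightarrow> z = - \<i> * of_real (hbar * (real n + 1/2))" for z n
    using hbar by (auto simp: complex_eq_iff field_simps)
  moreover have "w \<in> \<int>\<^sub>\<le>\<^sub>0 \<longleftrightarrow> (\<exists>n. w = - of_nat n)" for w :: complex
    by (auto elim: nonpos_Ints_cases')
  ultimately show ?thesis
    by (auto simp: is_pole_S_matrix_iff[OF hbar])
qed

section \<open>The scattering relations and the final statement\<close>

text \<open>At each nonzero \<open>x\<close> exactly one outgoing state is nonzero, and it picks the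
  diagonal entry precisely when \<open>\<sigma> * x > 0\<close>.\<close>

lemma psi_in_eq_S_matrix:
  assumes "\<sigma> \<in> {1, - 1}" and "x \<noteq> 0" and "hbar > 0"
  shows "psi_in hbar I \<sigma> x =
    S_matrix hbar (of_real I) $ (if \<sigma> = 1 then 1 else 2) $ 1 * psi_out hbar I 1 x +
    S_matrix hbar (of_real I) $ (if \<sigma> = 1 then 1 else 2) $ 2 * psi_out hbar I (- 1) x"
proof -
  have two: "(1 :: 2) \<noteq> 2" "(2 :: 2) \<noteq> 1" by simp_all
  consider "\<sigma> = 1" "x > 0" | "\<sigma> = 1" "x < 0" | "\<sigma> = - 1" "x > 0" | "\<sigma> = - 1" "x < 0"
    using assms by fastforce
  then show ?thesis
    unfolding psi_in_eq[OF assms] S_matrix_nth psi_out_def heaviside_def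
    by cases (simp_all add: two)
qed

text \<open>Integrability is asserted separately because \<open>integral\<close> returns 0 for a
  non-integrable function; it makes \<open>psi_in\<close> a genuine convergent integral. The poles
  are determined exactly, not merely exhibited.\<close>

theorem mainTheorem2:
  fixes f :: nat and hbar E I :: real
    and H :: "(nat \<Rightarrow>\<^sub>0 nat) \<Rightarrow>\<^sub>0 real" and n :: "nat \<Rightarrow> nat"
  assumes "f \<ge> 1"
    and "hbar > 0"
    and "polynomial_in f H"
    and "poly_eval H (action_point hbar I n) = E"
  shows "(\<forall>x. x \<noteq> 0 \<longrightarrow>
           psi_in_integrand hbar I 1 x integrable_on UNIV \<and>
           psi_in_integrand hbar I (- 1) x integrable_on UNIV \<and>
           psi_in hbar I 1 x =
             S_matrix hbar (of_real I) $ 1 $ 1 * psi_out hbar I 1 x +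
             S_matrix hbar (of_real I) $ 1 $ 2 * psi_out hbar I (- 1) x \<and>
           psi_in hbar I (- 1) x =
             S_matrix hbar (of_real I) $ 2 $ 1 * psi_out hbar I 1 x +
             S_matrix hbar (of_real I) $ 2 $ 2 * psi_out hbar I (- 1) x) \<and>
         transmission_probability (S_matrix hbar (of_real I)) =
           inverse (1 + exp (- 2 * pi * I / hbar)) \<and>
         (\<forall>i j. (\<lambda>z. S_matrix hbar z $ i $ j) meromorphic_on UNIV) \<and>
         {z. is_pole (S_matrix hbar) z} =
           range (\<lambda>n1::nat. - \<i> * of_real (hbar * (real n1 + 1/2)))"
proof (intro conjI allI impI)
  fix x :: real assume x: "x \<noteq> 0"
  show "psi_in_integrand hbar I 1 x integrable_on UNIV" "psi_in_integrand hbar I (- 1) x integrable_on UNIV"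
    by (rule has_integral_integrable[OF has_integral_psi_in_integrand]; use x assms(2) in simp)+
  show "psi_in hbar I 1 x =
      S_matrix hbar (of_real I) $ 1 $ 1 * psi_out hbar I 1 x +
      S_matrix hbar (of_real I) $ 1 $ 2 * psi_out hbar I (- 1) x"
    using psi_in_eq_S_matrix[of 1, OF _ x assms(2)] by simp
  show "psi_in hbar I (- 1) x =
      S_matrix hbar (of_real I) $ 2 $ 1 * psi_out hbar I 1 x +
      S_matrix hbar (of_real I) $ 2 $ 2 * psi_out hbar I (- 1) x"
    using psi_in_eq_S_matrix[of "- 1", OF _ x assms(2)] by simp
next
  show "transmission_probability (S_matrix hbar (of_real I)) = inverse (1 + exp (- 2 * pi * I / hbar))"
    by (rule transmission_probability_S_matrix[OF assms(2)])
  show "(\<lambda>z. S_matrix hbar z $ i $ j) meromorphic_on UNIV" for i j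
    by (rule meromorphic_S_matrix_nth[OF assms(2)])
  show "{z. is_pole (S_matrix hbar) z} = range (\<lambda>n1::nat. - \<i> * of_real (hbar * (real n1 + 1/2)))"
    by (rule poles_S_matrix[OF assms(2)])
qed

end
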